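(* Let $s,t$ be real numbers with $s\neq0$, $t\neq0$. Then \[ \sum_{n=1}^{\infty}\frac{t^n}{\{2n\}_{s,t}}=\sqrt{s^2+4t}\left[\mathrm{L}\!\left(\varphi_{s,t}^{\prime2}/t\right)-\mathrm{L}\!\left(\varphi_{s,t}^{\prime4}/t^2\right)\right]. \]
   Context: The generalized Fibonacci polynomials $\{n\}_{s,t}$ are defined by $\{0\}_{s,t}=0$, $\{1\}_{s,t}=1$, $\{n+2\}_{s,t}=s\{n+1\}_{s,t}+t\{n\}_{s,t}$. Set $\varphi'_{s,t}=\frac{s-\sqrt{s^2+4t}}{2}$. $\mathrm{L}(q)=\sum_{n=1}^{\infty}\frac{q^n}{1-q^n}$ is the Lambert series (identity understood where the series converge). *)

theory Defs
  imports Complex_Main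
begin

fun gen_fib :: "real \<Rightarrow> real \<Rightarrow> nat \<Rightarrow> real" where
  "gen_fib s t 0 = 0"
| "gen_fib s t (Suc 0) = 1"
| "gen_fib s t (Suc (Suc n)) = s * gen_fib s t (Suc n) + t * gen_fib s t n"

text \<open>The parameters are real, but \<open>s\<^sup>2 + 4 * t\<close> may be negative, where the library's real
  \<open>sqrt\<close> does not give a square root. Hence the principal complex square root, which agrees with
  the real one on nonnegative reals.\<close>

definition sqrt_disc :: "real \<Rightarrow> real \<Rightarrow> complex" where
  "sqrt_disc s t = csqrt (complex_of_real (s\<^sup>2 + 4 * t))"

definition phi_conj :: "real \<Rightarrow> real \<Rightarrow> complex" where
  "phi_conj s t = (complex_of_real s - sqrt_disc s t) / 2"

definition lambert :: "complex \<Rightarrow> complex" where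
  "lambert q = (\<Sum>n. q ^ Suc n / (1 - q ^ Suc n))"

text \<open>The first conjunct excludes terms with a vanishing denominator, which would otherwise count
  as \<open>0\<close>.\<close>

definition lambert_converges :: "complex \<Rightarrow> bool" where
  "lambert_converges q \<longleftrightarrow>
     (\<forall>n. q ^ Suc n \<noteq> 1) \<and> summable (\<lambda>n. q ^ Suc n / (1 - q ^ Suc n))"

end

theory Submission
  imports Defs
begin

text \<open>With \<open>\<phi> \<phi>' = - t\<close>, the number \<open>q = \<phi>'\<^sup>2 / t\<close> equals \<open>- \<phi>' / \<phi>\<close>, and Binet's formula turns
  \<open>t\<^sup>n / {2n}\<close> into \<open>\<surd>(s\<^sup>2 + 4t) q\<^sup>n / (1 - q\<^sup>2\<^sup>n)\<close>. The partial fraction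
  \<open>x / (1 - x\<^sup>2) = x / (1 - x) - x\<^sup>2 / (1 - x\<^sup>2)\<close> then splits the series termwise. The degenerate case
  \<open>s\<^sup>2 + 4t = 0\<close> would give \<open>q\<^sup>2 = 1\<close>, where the second Lambert series is undefined.\<close>

definition phi :: "real \<Rightarrow> real \<Rightarrow> complex" where
  "phi s t = (complex_of_real s + sqrt_disc s t) / 2"

lemma sqrt_disc_power2: "(sqrt_disc s t)\<^sup>2 = (complex_of_real s)\<^sup>2 + 4 * complex_of_real t"
  by (simp add: sqrt_disc_def)

lemma phi_power2: "(phi s t)\<^sup>2 = s * phi s t + t"
  using sqrt_disc_power2[of s t] by (simp add: phi_def field_simps power2_eq_square)

lemma phi_conj_power2: "(phi_conj s t)\<^sup>2 = s * phi_conj s t + t"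
  using sqrt_disc_power2[of s t] by (simp add: phi_conj_def field_simps power2_eq_square)

lemma phi_mult_phi_conj: "phi s t * phi_conj s t = - t"
  using sqrt_disc_power2[of s t] by (simp add: phi_def phi_conj_def field_simps power2_eq_square)

text \<open>Both sides satisfy the recurrence of \<open>gen_fib\<close>, because \<open>phi\<close>
  and \<open>phi_conj\<close> are roots of \<open>X^2 = s X + t\<close>. Keeping
  \<open>sqrt_disc\<close> as a factor avoids dividing by it, so a double root is covered.\<close>

lemma gen_fib_Binet:
  "sqrt_disc s t * complex_of_real (gen_fib s t n) = phi s t ^ n - phi_conj s t ^ n"
proof (induction n rule: gen_fib.induct[where P = "\<lambda>s t n.
    sqrt_disc s t * complex_of_real (gen_fib s t n) = phi s t ^ n - phi_conj s t ^ n"])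
  case (2 s t)
  show ?case by (simp add: phi_def phi_conj_def field_simps)
next
  case (3 s t n)
  have "phi s t ^ Suc (Suc n) - phi_conj s t ^ Suc (Suc n)
      = phi s t ^ n * (phi s t)\<^sup>2 - phi_conj s t ^ n * (phi_conj s t)\<^sup>2"
    by (simp add: power2_eq_square)
  also have "\<dots> = s * (phi s t ^ Suc n - phi_conj s t ^ Suc n) + t * (phi s t ^ n - phi_conj s t ^ n)"
    unfolding phi_power2 phi_conj_power2 by (simp add: algebra_simps)
  also have "\<dots> = sqrt_disc s t * complex_of_real (gen_fib s t (Suc (Suc n)))"
    unfolding 3[symmetric] by (simp add: algebra_simps)
  finally show ?case ..
qed simp

text \<open>Binet's formula at \<open>2 * n\<close>, multiplied by \<open>q ^ n\<close>: the first
  power turns into \<open>t ^ n\<close> by \<open>q * phi^2 = t\<close>, the second into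
  \<open>t ^ n * q ^ (2 * n)\<close> by \<open>phi_conj^2 = t * q\<close>. Without quotients by
  \<open>gen_fib\<close>, it can also show that \<open>gen_fib\<close> does not vanish.\<close>

lemma sqrt_disc_mult_gen_fib_even:
  fixes s t :: real
  assumes "t \<noteq> 0"
  defines "q \<equiv> (phi_conj s t)\<^sup>2 / complex_of_real t"
  shows "q ^ n * (sqrt_disc s t * complex_of_real (gen_fib s t (2 * n)))
    = complex_of_real t ^ n * (1 - (q ^ n)\<^sup>2)"
proof -
  have "q * (phi s t)\<^sup>2 = (phi s t * phi_conj s t)\<^sup>2 / t"
    by (simp add: q_def power_mult_distrib)
  also have "\<dots> = t"
    using assms(1) unfolding phi_mult_phi_conj by (simp add: power2_eq_square)
  finally have "q * (phi s t)\<^sup>2 = t" .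
  moreover have "(phi_conj s t)\<^sup>2 = t * q"
    using assms(1) by (simp add: q_def)
  moreover have "q ^ n * (sqrt_disc s t * complex_of_real (gen_fib s t (2 * n)))
      = (q * (phi s t)\<^sup>2) ^ n - (q * (phi_conj s t)\<^sup>2) ^ n"
    unfolding gen_fib_Binet power_mult power_mult_distrib by (simp only: right_diff_distrib)
  ultimately show ?thesis
    by (simp add: power_mult_distrib power2_eq_square right_diff_distrib mult_ac)
qed

theorem theorem9:
  fixes s t :: real
  assumes "s \<noteq> 0" and "t \<noteq> 0"
    and "lambert_converges ((phi_conj s t)\<^sup>2 / complex_of_real t)"
    and "lambert_converges ((phi_conj s t) ^ 4 / (complex_of_real t)\<^sup>2)"
  shows "(\<forall>n. gen_fib s t (2 * Suc n) \<noteq> 0) \<and>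
    (\<lambda>n. complex_of_real (t ^ Suc n / gen_fib s t (2 * Suc n))) sums
      (sqrt_disc s t *
        (lambert ((phi_conj s t)\<^sup>2 / complex_of_real t)
          - lambert ((phi_conj s t) ^ 4 / (complex_of_real t)\<^sup>2)))"
proof -
  define q where "q = (phi_conj s t)\<^sup>2 / complex_of_real t"
  have q2: "(phi_conj s t) ^ 4 / (complex_of_real t)\<^sup>2 = q\<^sup>2"
    by (simp add: q_def power_divide)
  \<comment> \<open>The second inequality is the absence of poles in the Lambert series at
    \<open>q\<^sup>2\<close>.\<close>
  have ne: "q ^ Suc n \<noteq> 1" "(q ^ Suc n)\<^sup>2 \<noteq> 1" for n
    using assms(3,4) unfolding q2 lambert_converges_def
    by (simp_all only: q_def[symmetric] power_mult[symmetric] mult.commute[of 2] not_False_eq_True)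
  have even: "q ^ n * (sqrt_disc s t * complex_of_real (gen_fib s t (2 * n)))
      = complex_of_real t ^ n * (1 - (q ^ n)\<^sup>2)" for n
    unfolding q_def by (rule sqrt_disc_mult_gen_fib_even) fact
  \<comment> \<open>A zero of \<open>gen_fib\<close> would make the left side of \<open>even\<close>
    vanish, but both factors on the right are nonzero.\<close>
  have nz: "gen_fib s t (2 * Suc n) \<noteq> 0" for n
    using even[of "Suc n"] ne(2)[of n] \<open>t \<noteq> 0\<close>
    by (auto simp del: gen_fib.simps mult_Suc_right power_Suc)
  have "(\<lambda>n. sqrt_disc s t *
      (q ^ Suc n / (1 - q ^ Suc n) - (q\<^sup>2) ^ Suc n / (1 - (q\<^sup>2) ^ Suc n)))
    sums (sqrt_disc s t * (lambert q - lambert (q\<^sup>2)))"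
    using assms(3,4) unfolding q2 lambert_converges_def lambert_def q_def[symmetric]
    by (intro sums_mult sums_diff summable_sums) auto
  moreover have "sqrt_disc s t *
      (q ^ Suc n / (1 - q ^ Suc n) - (q\<^sup>2) ^ Suc n / (1 - (q\<^sup>2) ^ Suc n))
    = complex_of_real (t ^ Suc n / gen_fib s t (2 * Suc n))" for n
  proof -
    define x where "x = q ^ Suc n"
    have x: "x \<noteq> 1" "x\<^sup>2 \<noteq> 1"
      using ne[of n] by (simp_all add: x_def)
    have "x / (1 - x) - x\<^sup>2 / (1 - x\<^sup>2) = x / (1 - x\<^sup>2)"
    proof -
      \<comment> \<open>Expanding by \<open>1 + x\<close> gives the common denominator
        \<open>1 - x^2\<close>; subtracting \<open>x^2\<close> from the numerator
        \<open>x + x^2\<close> leaves \<open>x\<close>.\<close>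
      have "x / (1 - x) = x * (1 + x) / (1 - x\<^sup>2)"
        using x by (simp add: divide_simps) (simp add: algebra_simps power2_eq_square)
      then show ?thesis
        by (simp add: diff_divide_distrib[symmetric] algebra_simps power2_eq_square)
    qed
    moreover have "x * (sqrt_disc s t * complex_of_real (gen_fib s t (2 * Suc n)))
        = complex_of_real t ^ Suc n * (1 - x\<^sup>2)"
      unfolding x_def by (rule even)
    \<comment> \<open>Only \<open>1 - x^2\<close> and \<open>gen_fib\<close> are divided out, both
      nonzero by \<open>ne\<close> and \<open>nz\<close>.\<close>
    then have "sqrt_disc s t * (x / (1 - x\<^sup>2))
        = complex_of_real t ^ Suc n / complex_of_real (gen_fib s t (2 * Suc n))"
      using x nz[of n] by (simp add: divide_simps del: gen_fib.simps mult_Suc_right power_Suc)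
        (simp add: mult_ac del: gen_fib.simps mult_Suc_right power_Suc)
    moreover have "(q\<^sup>2) ^ Suc n = x\<^sup>2"
      unfolding x_def by (simp only: power_mult[symmetric] mult.commute)
    ultimately show ?thesis
      by (simp add: x_def[symmetric] del: gen_fib.simps mult_Suc_right power_Suc)
  qed
  ultimately show ?thesis
    using nz unfolding q2 q_def[symmetric] by simp
qed

end
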